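(* Let $\Omega_A$ be an ordered context, $A_m$ a proposition of mode $m$, $C_r$ a proposition of mode $r$, $x$ a variable, and $n\geq 0$, such that $\Omega_A \geq m \geq r$ and $|m|\sim n$. Let $\Omega(x{:}A_m)^n$ denote an ordered context containing exactly $n$ occurrences of $x{:}A_m$ distributed among the other antecedents of $\Omega$, with $x$ not occurring in $\Omega_A$ nor elsewhere in $\Omega$, and let $\Omega(\Omega_A)^n$ denote the context obtained by replacing each of these $n$ occurrences by the sequence $\Omega_A$. If $\Omega_A \vdash A_m$ and $\Omega(x{:}A_m)^n \vdash C_r$ both have cut-free derivations in the ordered adjoint sequent calculus, then $\Omega(\Omega_A)^n \vdash C_r$ has a cut-free derivation.
   Context: Ordered adjoint sequent calculus. Fix a preorder $(\mathcal{M},\geq)$ of modes and, for each mode $m$, a set $\sigma(m)\subseteq\{\mathsf{W},\mathsf{C}^\leftarrow,\mathsf{C}^\rightarrow,\mathsf{M}^\leftarrow,\mathsf{M}^\rightarrow\}$ of structural properties (weakening, left/right contraction, left/right mobility) which is monotone: $k\geq m$ implies $\sigma(k)\supseteq\sigma(m)$. Propositions are indexed by modes: $A_m ::= P_m \mid A_m \rightarrowtail B_m \mid A_m \twoheadrightarrow B_m \mid A_m \,\&\, B_m \mid {\uparrow}^m_l A_l\ (m\geq l) \mid A_m\bullet B_m \mid 1_m \mid A_m\oplus B_m \mid {\downarrow}^k_m A_k\ (k\geq m)$, with $P_m$ atomic. An ordered context $\Omega$ is a finite sequence of labeled antecedents $x{:}A_m$; the same variable may occur several times, but all its occurrences label the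 same proposition. $\Omega\geq m$ means every antecedent $y{:}B_k$ of $\Omega$ satisfies $k\geq m$. A sequent $\Omega\vdash C_r$ presupposes $\Omega\geq r$. Variables newly introduced in premises are fresh. Rules (premises $\Rightarrow$ conclusion): (id) $\Rightarrow x{:}A_m\vdash A_m$. (cut) $\Omega_A\vdash A_m$ and $\Omega_L(x{:}A_m)\Omega_R\vdash C_r$ with $\Omega_A\geq m\geq r$ $\Rightarrow \Omega_L\Omega_A\Omega_R\vdash C_r$. ($1R$) $\Rightarrow \cdot\vdash 1_m$. ($1L$) $\Omega_L\Omega_R\vdash C_r \Rightarrow \Omega_L(x{:}1_m)\Omega_R\vdash C_r$. ($\bullet R$) $\Omega_1\vdash A_m$, $\Omega_2\vdash B_m\Rightarrow \Omega_1\Omega_2\vdash A_m\bullet B_m$. ($\bullet L$) $\Omega_L(x_1{:}A_m)(x_2{:}B_m)\Omega_R\vdash C_r\Rightarrow\Omega_L(x{:}A_m\bullet B_m)\Omega_R\vdash C_r$. ($\oplus R_i$) $\Omega\vdash A_m$ (resp. $\Omega\vdash B_m$) $\Rightarrow\Omega\vdash A_m\oplus B_m$. ($\oplus L$) $\Omega_L(y{:}A_m)\Omega_R\vdash C_r$ and $\Omega_L(y{:}B_m)\Omega_R\vdash C_r\Rightarrow\Omega_L(x{:}A_m\oplus B_m)\Omega_R\vdash C_r$. (${\downarrow}R$) $\Omega\vdash A_k$ with $\Omega\geq k\Rightarrow\Omega\vdash{\downarrow}^k_mA_k$. (${\downarrow}L$) $\Omega_L(y{:}A_k)\Omega_R\vdash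 C_r\Rightarrow\Omega_L(x{:}{\downarrow}^k_mA_k)\Omega_R\vdash C_r$. ($\twoheadrightarrow R$) $\Omega(x{:}A_m)\vdash B_m\Rightarrow\Omega\vdash A_m\twoheadrightarrow B_m$. ($\twoheadrightarrow L$) $\Omega_A\vdash A_m$, $\Omega_A\geq m$, $\Omega_L(y{:}B_m)\Omega_R\vdash C_r\Rightarrow\Omega_L(f{:}A_m\twoheadrightarrow B_m)\Omega_A\Omega_R\vdash C_r$. ($\rightarrowtail R$) $(x{:}A_m)\Omega\vdash B_m\Rightarrow\Omega\vdash A_m\rightarrowtail B_m$. ($\rightarrowtail L$) $\Omega_A\vdash A_m$, $\Omega_A\geq m$, $\Omega_L(y{:}B_m)\Omega_R\vdash C_r\Rightarrow\Omega_L\Omega_A(f{:}A_m\rightarrowtail B_m)\Omega_R\vdash C_r$. ($\& R$) $\Omega\vdash A_m$, $\Omega\vdash B_m\Rightarrow\Omega\vdash A_m\&B_m$. ($\& L_i$) $\Omega_L(y{:}A_m)\Omega_R\vdash C_r$ (resp. $y{:}B_m$) $\Rightarrow\Omega_L(x{:}A_m\&B_m)\Omega_R\vdash C_r$. (${\uparrow}R$) $\Omega\vdash A_l\Rightarrow\Omega\vdash{\uparrow}^m_lA_l$. (${\uparrow}L$) $\Omega_L(y{:}A_l)\Omega_R\vdash C_r$ with $l\geq r\Rightarrow\Omega_L(x{:}{\uparrow}^m_lA_l)\Omega_R\vdash C_r$. Structural rules: ($\mathsf{M}^\leftarrow$) $\Omega_L\Omega_M(x{:}A_m)\Omega_R\vdash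 C_r$, $\mathsf{M}^\leftarrow\in\sigma(m)\Rightarrow\Omega_L(x{:}A_m)\Omega_M\Omega_R\vdash C_r$. ($\mathsf{M}^\rightarrow$) $\Omega_L(x{:}A_m)\Omega_M\Omega_R\vdash C_r$, $\mathsf{M}^\rightarrow\in\sigma(m)\Rightarrow\Omega_L\Omega_M(x{:}A_m)\Omega_R\vdash C_r$. ($\mathsf{C}^\leftarrow$) $\Omega_L(x{:}A_m)\Omega_M(x{:}A_m)\Omega_R\vdash C_r$, $\mathsf{C}^\leftarrow\in\sigma(m)\Rightarrow\Omega_L(x{:}A_m)\Omega_M\Omega_R\vdash C_r$. ($\mathsf{C}^\rightarrow$) $\Omega_L(x{:}A_m)\Omega_M(x{:}A_m)\Omega_R\vdash C_r$, $\mathsf{C}^\rightarrow\in\sigma(m)\Rightarrow\Omega_L\Omega_M(x{:}A_m)\Omega_R\vdash C_r$. ($\mathsf{W}$) $\Omega_L\Omega_R\vdash C_r$, $\mathsf{W}\in\sigma(m)\Rightarrow\Omega_L(x{:}A_m)\Omega_R\vdash C_r$. A derivation is cut-free if it does not use (cut). The compatibility relation $|m|\sim n$ holds iff: $n=0$ and $\mathsf{W}\in\sigma(m)$; or $n=1$; or $n>1$ and ($\mathsf{C}^\leftarrow\in\sigma(m)$ or $\mathsf{C}^\rightarrow\in\sigma(m)$). *)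

theory Defs
  imports Main
begin

text \<open>The arrows in rule and property names are rendered as suffixes: \<open>L\<close> for left, \<open>R\<close> for right.\<close>

datatype structural_property = Weak | ContrL | ContrR | MobL | MobR

text \<open>
  Raw propositions over atoms \<open>'p\<close> and modes \<open>'m\<close>. \<open>LImp\<close> is the implication written with a
  tailed arrow (argument on the left of the context), \<open>RImp\<close> the one written with a
  two-headed arrow (argument on the right). \<open>Atom P m\<close> is the atom \<open>P\<close> at mode \<open>m\<close>. The shifts
  record only their own mode; the other index is the mode of the argument. The grammar of
  mode-indexed propositions is \<open>wf_prop\<close>: \<open>A\<close> is a proposition of mode \<open>m\<close> iff
  \<open>wf_prop A \<and> mode A = m\<close>.
\<close>

datatype ('p, 'm) formula =
    Atom 'p 'm
  | LImp "('p, 'm) formula" "('p, 'm) formula"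
  | RImp "('p, 'm) formula" "('p, 'm) formula"
  | With "('p, 'm) formula" "('p, 'm) formula"
  | Up 'm "('p, 'm) formula"
  | Fuse "('p, 'm) formula" "('p, 'm) formula"
  | One 'm
  | Plus "('p, 'm) formula" "('p, 'm) formula"
  | Down 'm "('p, 'm) formula"

primrec mode :: "('p, 'm) formula \<Rightarrow> 'm" where
  "mode (Atom P m) = m"
| "mode (LImp A B) = mode A"
| "mode (RImp A B) = mode A"
| "mode (With A B) = mode A"
| "mode (Up m A) = m"
| "mode (Fuse A B) = mode A"
| "mode (One m) = m"
| "mode (Plus A B) = mode A"
| "mode (Down m A) = m"

primrec wf_prop :: "('p, 'm::preorder) formula \<Rightarrow> bool" where
  "wf_prop (Atom P m) \<longleftrightarrow> True"
| "wf_prop (LImp A B) \<longleftrightarrow> wf_prop A \<and> wf_prop B \<and> mode A = mode B"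
| "wf_prop (RImp A B) \<longleftrightarrow> wf_prop A \<and> wf_prop B \<and> mode A = mode B"
| "wf_prop (With A B) \<longleftrightarrow> wf_prop A \<and> wf_prop B \<and> mode A = mode B"
| "wf_prop (Up m A) \<longleftrightarrow> wf_prop A \<and> m \<ge> mode A"
| "wf_prop (Fuse A B) \<longleftrightarrow> wf_prop A \<and> wf_prop B \<and> mode A = mode B"
| "wf_prop (One m) \<longleftrightarrow> True"
| "wf_prop (Plus A B) \<longleftrightarrow> wf_prop A \<and> wf_prop B \<and> mode A = mode B"
| "wf_prop (Down m A) \<longleftrightarrow> wf_prop A \<and> mode A \<ge> m"

type_synonym var = nat

type_synonym ('p, 'm) ctx = "(var \<times> ('p, 'm) formula) list"

abbreviation vars :: "('p, 'm) ctx \<Rightarrow> var set" where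
  "vars \<Omega> \<equiv> fst ` set \<Omega>"

definition ordered_context :: "('p, 'm::preorder) ctx \<Rightarrow> bool" where
  "ordered_context \<Omega> \<longleftrightarrow>
     (\<forall>(y, B) \<in> set \<Omega>. wf_prop B) \<and>
     (\<forall>y B B'. (y, B) \<in> set \<Omega> \<longrightarrow> (y, B') \<in> set \<Omega> \<longrightarrow> B = B')"

definition ctx_geq :: "('p, 'm::preorder) ctx \<Rightarrow> 'm \<Rightarrow> bool" where
  "ctx_geq \<Omega> m \<longleftrightarrow> (\<forall>(y, B) \<in> set \<Omega>. mode B \<ge> m)"

datatype ('p, 'm) sequent = Sequent "('p, 'm) ctx" "('p, 'm) formula"  (infix \<open>\<turnstile>\<close> 50)

fun is_sequent :: "('p, 'm::preorder) sequent \<Rightarrow> bool" where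
  "is_sequent (\<Omega> \<turnstile> C) \<longleftrightarrow> ordered_context \<Omega> \<and> wf_prop C \<and> ctx_geq \<Omega> (mode C)"

text \<open>
  Instances of the rules other than cut, as premise list and conclusion. Well-formedness of
  all sequents involved is imposed once and for all in \<open>derivable\<close> below. Variables introduced in
  premises are required not to occur in the conclusion.
\<close>

inductive inference ::
  "('m::preorder \<Rightarrow> structural_property set) \<Rightarrow>
    ('p, 'm) sequent list \<Rightarrow> ('p, 'm) sequent \<Rightarrow> bool"
  for \<sigma>
where
  Id: "inference \<sigma> [] ([(x, A)] \<turnstile> A)"
| OneR: "inference \<sigma> [] ([] \<turnstile> One m)"
| OneL: "inference \<sigma> [\<Omega>L @ \<Omega>R \<turnstile> C] (\<Omega>L @ [(x, One m)] @ \<Omega>R \<turnstile> C)"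
| FuseR: "inference \<sigma> [\<Omega>1 \<turnstile> A, \<Omega>2 \<turnstile> B] (\<Omega>1 @ \<Omega>2 \<turnstile> Fuse A B)"
| FuseL:
    "x1 \<noteq> x2 \<Longrightarrow> x1 \<notin> vars (\<Omega>L @ [(x, Fuse A B)] @ \<Omega>R) \<Longrightarrow> x2 \<notin> vars (\<Omega>L @ [(x, Fuse A B)] @ \<Omega>R) \<Longrightarrow>
     inference \<sigma> [\<Omega>L @ [(x1, A), (x2, B)] @ \<Omega>R \<turnstile> C] (\<Omega>L @ [(x, Fuse A B)] @ \<Omega>R \<turnstile> C)"
| PlusR1: "inference \<sigma> [\<Omega> \<turnstile> A] (\<Omega> \<turnstile> Plus A B)"
| PlusR2: "inference \<sigma> [\<Omega> \<turnstile> B] (\<Omega> \<turnstile> Plus A B)"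
| PlusL:
    "y \<notin> vars (\<Omega>L @ [(x, Plus A B)] @ \<Omega>R) \<Longrightarrow>
     inference \<sigma> [\<Omega>L @ [(y, A)] @ \<Omega>R \<turnstile> C, \<Omega>L @ [(y, B)] @ \<Omega>R \<turnstile> C]
       (\<Omega>L @ [(x, Plus A B)] @ \<Omega>R \<turnstile> C)"
| DownR: "ctx_geq \<Omega> (mode A) \<Longrightarrow> inference \<sigma> [\<Omega> \<turnstile> A] (\<Omega> \<turnstile> Down m A)"
| DownL:
    "y \<notin> vars (\<Omega>L @ [(x, Down m A)] @ \<Omega>R) \<Longrightarrow>
     inference \<sigma> [\<Omega>L @ [(y, A)] @ \<Omega>R \<turnstile> C] (\<Omega>L @ [(x, Down m A)] @ \<Omega>R \<turnstile> C)"
| RImpR: "x \<notin> vars \<Omega> \<Longrightarrow> inference \<sigma> [\<Omega> @ [(x, A)] \<turnstile> B] (\<Omega> \<turnstile> RImp A B)"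
| RImpL:
    "ctx_geq \<Omega>A (mode A) \<Longrightarrow> y \<notin> vars (\<Omega>L @ [(f, RImp A B)] @ \<Omega>A @ \<Omega>R) \<Longrightarrow>
     inference \<sigma> [\<Omega>A \<turnstile> A, \<Omega>L @ [(y, B)] @ \<Omega>R \<turnstile> C] (\<Omega>L @ [(f, RImp A B)] @ \<Omega>A @ \<Omega>R \<turnstile> C)"
| LImpR: "x \<notin> vars \<Omega> \<Longrightarrow> inference \<sigma> [[(x, A)] @ \<Omega> \<turnstile> B] (\<Omega> \<turnstile> LImp A B)"
| LImpL:
    "ctx_geq \<Omega>A (mode A) \<Longrightarrow> y \<notin> vars (\<Omega>L @ \<Omega>A @ [(f, LImp A B)] @ \<Omega>R) \<Longrightarrow>
     inference \<sigma> [\<Omega>A \<turnstile> A, \<Omega>L @ [(y, B)] @ \<Omega>R \<turnstile> C] (\<Omega>L @ \<Omega>A @ [(f, LImp A B)] @ \<Omega>R \<turnstile> C)"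
| WithR: "inference \<sigma> [\<Omega> \<turnstile> A, \<Omega> \<turnstile> B] (\<Omega> \<turnstile> With A B)"
| WithL1:
    "y \<notin> vars (\<Omega>L @ [(x, With A B)] @ \<Omega>R) \<Longrightarrow>
     inference \<sigma> [\<Omega>L @ [(y, A)] @ \<Omega>R \<turnstile> C] (\<Omega>L @ [(x, With A B)] @ \<Omega>R \<turnstile> C)"
| WithL2:
    "y \<notin> vars (\<Omega>L @ [(x, With A B)] @ \<Omega>R) \<Longrightarrow>
     inference \<sigma> [\<Omega>L @ [(y, B)] @ \<Omega>R \<turnstile> C] (\<Omega>L @ [(x, With A B)] @ \<Omega>R \<turnstile> C)"
| UpR: "inference \<sigma> [\<Omega> \<turnstile> A] (\<Omega> \<turnstile> Up m A)"
| UpL: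
    "mode A \<ge> mode C \<Longrightarrow> y \<notin> vars (\<Omega>L @ [(x, Up m A)] @ \<Omega>R) \<Longrightarrow>
     inference \<sigma> [\<Omega>L @ [(y, A)] @ \<Omega>R \<turnstile> C] (\<Omega>L @ [(x, Up m A)] @ \<Omega>R \<turnstile> C)"
| MoveL:
    "MobL \<in> \<sigma> (mode A) \<Longrightarrow>
     inference \<sigma> [\<Omega>L @ \<Omega>M @ [(x, A)] @ \<Omega>R \<turnstile> C] (\<Omega>L @ [(x, A)] @ \<Omega>M @ \<Omega>R \<turnstile> C)"
| MoveR:
    "MobR \<in> \<sigma> (mode A) \<Longrightarrow>
     inference \<sigma> [\<Omega>L @ [(x, A)] @ \<Omega>M @ \<Omega>R \<turnstile> C] (\<Omega>L @ \<Omega>M @ [(x, A)] @ \<Omega>R \<turnstile> C)"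
| ContractL:
    "ContrL \<in> \<sigma> (mode A) \<Longrightarrow>
     inference \<sigma> [\<Omega>L @ [(x, A)] @ \<Omega>M @ [(x, A)] @ \<Omega>R \<turnstile> C] (\<Omega>L @ [(x, A)] @ \<Omega>M @ \<Omega>R \<turnstile> C)"
| ContractR:
    "ContrR \<in> \<sigma> (mode A) \<Longrightarrow>
     inference \<sigma> [\<Omega>L @ [(x, A)] @ \<Omega>M @ [(x, A)] @ \<Omega>R \<turnstile> C] (\<Omega>L @ \<Omega>M @ [(x, A)] @ \<Omega>R \<turnstile> C)"
| Weaken: "Weak \<in> \<sigma> (mode A) \<Longrightarrow> inference \<sigma> [\<Omega>L @ \<Omega>R \<turnstile> C] (\<Omega>L @ [(x, A)] @ \<Omega>R \<turnstile> C)"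

inductive cut_rule :: "('p, 'm::preorder) sequent list \<Rightarrow> ('p, 'm) sequent \<Rightarrow> bool" where
  Cut:
    "ctx_geq \<Omega>A (mode A) \<Longrightarrow> mode A \<ge> mode C \<Longrightarrow> x \<notin> vars (\<Omega>L @ \<Omega>A @ \<Omega>R) \<Longrightarrow>
     cut_rule [\<Omega>A \<turnstile> A, \<Omega>L @ [(x, A)] @ \<Omega>R \<turnstile> C] (\<Omega>L @ \<Omega>A @ \<Omega>R \<turnstile> C)"

inductive derivable ::
  "(('p, 'm::preorder) sequent list \<Rightarrow> ('p, 'm) sequent \<Rightarrow> bool) \<Rightarrow> ('p, 'm) sequent \<Rightarrow> bool"
  for R
where
  step: "R ps s \<Longrightarrow> is_sequent s \<Longrightarrow> (\<forall>p \<in> set ps. derivable R p) \<Longrightarrow> derivable R s"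

definition provable ::
  "('m::preorder \<Rightarrow> structural_property set) \<Rightarrow> ('p, 'm) sequent \<Rightarrow> bool" where
  "provable \<sigma> = derivable (\<lambda>ps s. inference \<sigma> ps s \<or> cut_rule ps s)"

definition cut_free_provable ::
  "('m::preorder \<Rightarrow> structural_property set) \<Rightarrow> ('p, 'm) sequent \<Rightarrow> bool" where
  "cut_free_provable \<sigma> = derivable (inference \<sigma>)"

definition compatible :: "('m \<Rightarrow> structural_property set) \<Rightarrow> 'm \<Rightarrow> nat \<Rightarrow> bool" where
  "compatible \<sigma> m n \<longleftrightarrow>
     (n = 0 \<and> Weak \<in> \<sigma> m) \<or> n = 1 \<or> (n > 1 \<and> (ContrL \<in> \<sigma> m \<or> ContrR \<in> \<sigma> m))"

definition replace_all :: "'a \<Rightarrow> 'a list \<Rightarrow> 'a list \<Rightarrow> 'a list" where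
  "replace_all a zs xs = concat (map (\<lambda>b. if b = a then zs else [b]) xs)"

end

theory Submission
  imports Defs
begin

text \<open>
  The induction on the derivation of \<open>C\<close> runs over arbitrary simultaneous substitutions of
  contexts for antecedents. It thereby handles all occurrences of the cut formula and the renaming
  of eigenvariables at once; a structural rule on \<open>x : A\<close> becomes the same rule applied to
  each antecedent of the substituted block, which monotonicity of \<open>\<sigma>\<close> permits. Only when a left
  rule decomposes one occurrence of \<open>A\<close> is the derivation of \<open>A\<close> inspected. At that point a single
  occurrence is left, so the left and structural rules of that derivation permute below the cut
  without being duplicated, and its final right rule gives cuts on proper subformulas.
\<close>

section \<open>Mode bounds, well-formed contexts and fresh names\<close>

lemma ctx_geq_append [simp]: "ctx_geq (\<Omega> @ \<Omega>') m \<longleftrightarrow> ctx_geq \<Omega> m \<and> ctx_geq \<Omega>' m"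
  by (auto simp: ctx_geq_def)

lemma ctx_geq_Cons [simp]: "ctx_geq (b # \<Omega>) m \<longleftrightarrow> m \<le> mode (snd b) \<and> ctx_geq \<Omega> m"
  by (auto simp: ctx_geq_def)

lemma ctx_geq_Nil [simp]: "ctx_geq [] m"
  by (simp add: ctx_geq_def)

lemma ctx_geq_trans: "ctx_geq \<Omega> k \<Longrightarrow> m \<le> k \<Longrightarrow> ctx_geq \<Omega> m"
  by (auto simp: ctx_geq_def intro: order_trans)

lemma ctx_geq_rename [simp]: "ctx_geq (map (apfst f) \<Omega>) m \<longleftrightarrow> ctx_geq \<Omega> m"
  by (auto simp: ctx_geq_def)

text \<open>By transitivity: each block lies above the mode of the antecedent it replaces, and that
  mode lies above \<open>m\<close>.\<close>

lemma ctx_geq_concat: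
  assumes "ctx_geq \<Omega> m" and "\<forall>b \<in> set \<Omega>. ctx_geq (\<theta> b) (mode (snd b))"
  shows "ctx_geq (concat (map \<theta> \<Omega>)) m"
  using assms by (induction \<Omega>) (auto intro: ctx_geq_trans)

text \<open>Well-formedness depends only on the set of antecedents, so moving, contracting or
  deleting antecedents preserves it.\<close>

lemma ordered_context_mono: "ordered_context \<Omega> \<Longrightarrow> set \<Omega>' \<subseteq> set \<Omega> \<Longrightarrow> ordered_context \<Omega>'"
  unfolding ordered_context_def by blast

lemma is_sequent_mono: "is_sequent (\<Omega> \<turnstile> C) \<Longrightarrow> set \<Omega>' \<subseteq> set \<Omega> \<Longrightarrow> is_sequent (\<Omega>' \<turnstile> C)"
  using ordered_context_mono[of \<Omega> \<Omega>'] by (auto simp: ctx_geq_def)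

text \<open>A new name cannot conflict with an existing label. The set inclusion allows the
  eigenvariable to be inserted at any position.\<close>

lemma ordered_context_fresh:
  assumes "ordered_context \<Omega>" and "y \<notin> vars \<Omega>" and "wf_prop B" and "set \<Omega>' \<subseteq> insert (y, B) (set \<Omega>)"
  shows "ordered_context \<Omega>'"
proof -
  have "(y, B') \<notin> set \<Omega>" for B'
    using assms(2) by force
  then have "ordered_context ((y, B) # \<Omega>)"
    using assms(1,3) unfolding ordered_context_def by simp
  then show ?thesis
    by (rule ordered_context_mono) (use assms(4) in simp)
qed

text \<open>Lets a substitution be extended to an eigenvariable without changing its effect on the
  side contexts.\<close>

lemma map_update_fresh:
  "y \<notin> vars \<Omega> \<Longrightarrow> map (\<theta>((y, B) := \<Delta>)) \<Omega> = map \<theta> \<Omega>"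
  by (intro map_cong refl) (auto simp: image_iff)

lemma rename_update_fresh:
  "y \<notin> vars \<Omega> \<Longrightarrow> map (apfst (f(y := z))) \<Omega> = map (apfst f) \<Omega>"
  by (intro map_cong refl) (auto simp: image_iff apfst_def map_prod_def)

lemma ex_fresh: "\<exists>y. y \<notin> vars \<Omega>"
  by (rule ex_new_if_finite) (auto simp: infinite_UNIV_nat)

section \<open>Cut-free derivability and its induction principle\<close>

locale ordered_adjoint =
  fixes \<sigma> :: "'m::preorder \<Rightarrow> structural_property set"
  assumes mono: "l \<le> k \<Longrightarrow> \<sigma> l \<subseteq> \<sigma> k"
begin

abbreviation der :: "('p, 'm) ctx \<Rightarrow> ('p, 'm) formula \<Rightarrow> bool" where
  "der \<Omega> C \<equiv> cut_free_provable \<sigma> (\<Omega> \<turnstile> C)"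

lemma derI:
  "inference \<sigma> ps (\<Omega> \<turnstile> C) \<Longrightarrow> is_sequent (\<Omega> \<turnstile> C) \<Longrightarrow> \<forall>p \<in> set ps. cut_free_provable \<sigma> p \<Longrightarrow> der \<Omega> C"
  unfolding cut_free_provable_def by (rule derivable.step)

lemma der_is_sequent: "der \<Omega> C \<Longrightarrow> is_sequent (\<Omega> \<turnstile> C)"
  unfolding cut_free_provable_def by (erule derivable.cases) simp

lemma derD:
  assumes "der \<Omega> C"
  shows "ordered_context \<Omega>" and "wf_prop C" and "ctx_geq \<Omega> (mode C)"
  using der_is_sequent[OF assms] by auto

text \<open>Splits sequents into context and succedent, and supplies the derivability of each
  premise beside its induction hypothesis, since the well-formedness of a premise is read off from
  it.\<close>

lemma der_induct [consumes 1, case_names step]: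
  assumes "der \<Omega> C"
    and step: "\<And>ps \<Omega> C. inference \<sigma> ps (\<Omega> \<turnstile> C) \<Longrightarrow> is_sequent (\<Omega> \<turnstile> C) \<Longrightarrow>
      (\<And>\<Omega>' C'. (\<Omega>' \<turnstile> C') \<in> set ps \<Longrightarrow> der \<Omega>' C') \<Longrightarrow>
      (\<And>\<Omega>' C'. (\<Omega>' \<turnstile> C') \<in> set ps \<Longrightarrow> P \<Omega>' C') \<Longrightarrow> P \<Omega> C"
  shows "P \<Omega> C"
proof -
  have "case s of \<Omega> \<turnstile> C \<Rightarrow> P \<Omega> C" if "derivable (inference \<sigma>) s" for s
    using that
  proof (induction rule: derivable.induct)
    case (step ps s)
    obtain \<Omega> C where s: "s = (\<Omega> \<turnstile> C)"
      by (cases s)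
    have "P \<Omega> C"
    proof (rule assms(2)[of ps])
      fix \<Omega>' C'
      assume "(\<Omega>' \<turnstile> C') \<in> set ps"
      with step show "der \<Omega>' C'" and "P \<Omega>' C'"
        by (auto simp: cut_free_provable_def)
    qed (use step s in simp_all)
    then show ?case
      by (simp add: s)
  qed
  from this[of "\<Omega> \<turnstile> C"] show ?thesis
    using assms(1) by (simp add: cut_free_provable_def)
qed

lemma der_Id: "wf_prop A \<Longrightarrow> der [(x, A)] A"
  by (rule derI[OF Id]) (auto simp: ordered_context_def)

subsection \<open>Structural rules for blocks\<close>

text \<open>The antecedents cross \<open>\<Omega>M\<close> one at a time, the first one first, which
  preserves their order. Each has a mode above \<open>m\<close>, so monotonicity grants it
  mobility.\<close>

lemma der_move_left_block:
  assumes "der (\<Omega>L @ \<Omega>M @ \<Delta> @ \<Omega>R) C" and "MobL \<in> \<sigma> m" and "ctx_geq \<Delta> m"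
  shows "der (\<Omega>L @ \<Delta> @ \<Omega>M @ \<Omega>R) C"
  using assms
proof (induction \<Delta> arbitrary: \<Omega>L)
  case (Cons b \<Delta>)
  obtain y B where b: "b = (y, B)"
    by (cases b)
  have "der (\<Omega>L @ [(y, B)] @ \<Omega>M @ (\<Delta> @ \<Omega>R)) C"
  proof (rule derI[OF MoveL])
    show "MobL \<in> \<sigma> (mode B)"
      using Cons.prems mono by (auto simp: b)
    show "is_sequent (\<Omega>L @ [(y, B)] @ \<Omega>M @ \<Delta> @ \<Omega>R \<turnstile> C)"
      by (rule is_sequent_mono[OF der_is_sequent[OF Cons.prems(1)]]) (auto simp: b)
  qed (use Cons.prems in \<open>simp add: b\<close>)
  then show ?case
    using Cons.IH[of "\<Omega>L @ [(y, B)]"] Cons.prems by (simp add: b)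
qed simp

text \<open>Mirror image of the previous argument: the last antecedent of the block moves
  first.\<close>

lemma der_move_right_block:
  assumes "der (\<Omega>L @ \<Delta> @ \<Omega>M @ \<Omega>R) C" and "MobR \<in> \<sigma> m" and "ctx_geq \<Delta> m"
  shows "der (\<Omega>L @ \<Omega>M @ \<Delta> @ \<Omega>R) C"
  using assms
proof (induction \<Delta> arbitrary: \<Omega>R rule: rev_induct)
  case (snoc b \<Delta>)
  obtain y B where b: "b = (y, B)"
    by (cases b)
  have "der ((\<Omega>L @ \<Delta>) @ \<Omega>M @ [(y, B)] @ \<Omega>R) C"
  proof (rule derI[OF MoveR])
    show "MobR \<in> \<sigma> (mode B)"
      using snoc.prems mono by (auto simp: b)
    show "is_sequent ((\<Omega>L @ \<Delta>) @ \<Omega>M @ [(y, B)] @ \<Omega>R \<turnstile> C)"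
      by (rule is_sequent_mono[OF der_is_sequent[OF snoc.prems(1)]]) (auto simp: b)
  qed (use snoc.prems in \<open>simp add: b\<close>)
  then show ?case
    using snoc.IH[of "[(y, B)] @ \<Omega>R"] snoc.prems by (simp add: b)
qed simp

text \<open>Each antecedent of the second block is contracted against an occurrence of it in
  \<open>\<Delta>\<close>. Asking for \<open>set \<Delta>' \<subseteq> set \<Delta>\<close> instead
  of equal blocks lets the second block shrink in the induction while the first one stays.\<close>

lemma der_contract_left_block:
  assumes "der (\<Omega>L @ \<Delta> @ \<Omega>M @ \<Delta>' @ \<Omega>R) C" and "set \<Delta>' \<subseteq> set \<Delta>"
    and "ContrL \<in> \<sigma> m" and "ctx_geq \<Delta> m"
  shows "der (\<Omega>L @ \<Delta> @ \<Omega>M @ \<Omega>R) C"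
  using assms
proof (induction \<Delta>')
  case (Cons b \<Delta>')
  obtain y B where b: "b = (y, B)"
    by (cases b)
  obtain \<Delta>1 \<Delta>2 where \<Delta>: "\<Delta> = \<Delta>1 @ (y, B) # \<Delta>2"
    using Cons.prems(2) split_list[of "(y, B)" \<Delta>] by (auto simp: b)
  have "der ((\<Omega>L @ \<Delta>1) @ [(y, B)] @ (\<Delta>2 @ \<Omega>M) @ (\<Delta>' @ \<Omega>R)) C"
  proof (rule derI[OF ContractL])
    show "ContrL \<in> \<sigma> (mode B)"
      using Cons.prems mono by (auto simp: \<Delta>)
    show "is_sequent ((\<Omega>L @ \<Delta>1) @ [(y, B)] @ (\<Delta>2 @ \<Omega>M) @ (\<Delta>' @ \<Omega>R) \<turnstile> C)"
      by (rule is_sequent_mono[OF der_is_sequent[OF Cons.prems(1)]]) (auto simp: b \<Delta>)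
  qed (use Cons.prems in \<open>simp add: b \<Delta>\<close>)
  then show ?case
    using Cons.IH Cons.prems by (simp add: b \<Delta>)
qed simp

text \<open>Here the block on the right survives, and the one on the left is consumed from its right
  end.\<close>

lemma der_contract_right_block:
  assumes "der (\<Omega>L @ \<Delta>' @ \<Omega>M @ \<Delta> @ \<Omega>R) C" and "set \<Delta>' \<subseteq> set \<Delta>"
    and "ContrR \<in> \<sigma> m" and "ctx_geq \<Delta> m"
  shows "der (\<Omega>L @ \<Omega>M @ \<Delta> @ \<Omega>R) C"
  using assms
proof (induction \<Delta>' rule: rev_induct)
  case (snoc b \<Delta>')
  obtain y B where b: "b = (y, B)"
    by (cases b)
  obtain \<Delta>1 \<Delta>2 where \<Delta>: "\<Delta> = \<Delta>1 @ (y, B) # \<Delta>2"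
    using snoc.prems(2) split_list[of "(y, B)" \<Delta>] by (auto simp: b)
  have "der ((\<Omega>L @ \<Delta>') @ (\<Omega>M @ \<Delta>1) @ [(y, B)] @ (\<Delta>2 @ \<Omega>R)) C"
  proof (rule derI[OF ContractR])
    show "ContrR \<in> \<sigma> (mode B)"
      using snoc.prems mono by (auto simp: \<Delta>)
    show "is_sequent ((\<Omega>L @ \<Delta>') @ (\<Omega>M @ \<Delta>1) @ [(y, B)] @ (\<Delta>2 @ \<Omega>R) \<turnstile> C)"
      by (rule is_sequent_mono[OF der_is_sequent[OF snoc.prems(1)]]) (auto simp: b \<Delta>)
  qed (use snoc.prems in \<open>simp add: b \<Delta>\<close>)
  then show ?case
    using snoc.IH snoc.prems by (simp add: b \<Delta>)
qed simp

text \<open>Weakening is the one structural rule whose conclusion has new antecedents, so the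
  well-formedness of the conclusion is a hypothesis instead of following from the premise.\<close>

lemma der_weaken_block:
  assumes "der (\<Omega>L @ \<Omega>R) C" and "is_sequent (\<Omega>L @ \<Delta> @ \<Omega>R \<turnstile> C)"
    and "Weak \<in> \<sigma> m" and "ctx_geq \<Delta> m"
  shows "der (\<Omega>L @ \<Delta> @ \<Omega>R) C"
  using assms
proof (induction \<Delta>)
  case (Cons b \<Delta>)
  obtain y B where b: "b = (y, B)"
    by (cases b)
  have "der (\<Omega>L @ [(y, B)] @ (\<Delta> @ \<Omega>R)) C"
  proof (rule derI[OF Weaken])
    show "Weak \<in> \<sigma> (mode B)"
      using Cons.prems mono by (auto simp: b)
    show "is_sequent (\<Omega>L @ [(y, B)] @ \<Delta> @ \<Omega>R \<turnstile> C)"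
      using Cons.prems(2) by (simp add: b)
    have "is_sequent (\<Omega>L @ \<Delta> @ \<Omega>R \<turnstile> C)"
      by (rule is_sequent_mono[OF Cons.prems(2)]) (auto simp: b)
    then show "\<forall>p \<in> set [\<Omega>L @ \<Delta> @ \<Omega>R \<turnstile> C]. cut_free_provable \<sigma> p"
      using Cons.IH Cons.prems by (simp add: b)
  qed
  then show ?case
    by (simp add: b)
qed simp

subsection \<open>Premises of the logical rules\<close>

text \<open>
  Eigenvariables are quantified universally over all sufficiently fresh names, so that a user of
  these premises may choose them fresh for any further context.
\<close>

primrec left_premises ::
  "('p, 'm) ctx \<Rightarrow> ('p, 'm) ctx \<Rightarrow> ('p, 'm) formula \<Rightarrow> ('p, 'm) formula \<Rightarrow> bool" where
  "left_premises \<Omega>L \<Omega>R C (Atom P m) \<longleftrightarrow> False"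
| "left_premises \<Omega>L \<Omega>R C (LImp A B) \<longleftrightarrow>
    (\<exists>\<Omega> \<Omega>A. \<Omega>L = \<Omega> @ \<Omega>A \<and> ctx_geq \<Omega>A (mode A) \<and> der \<Omega>A A \<and>
      (\<forall>y. y \<notin> vars (\<Omega>L @ \<Omega>R) \<longrightarrow> der (\<Omega> @ [(y, B)] @ \<Omega>R) C))"
| "left_premises \<Omega>L \<Omega>R C (RImp A B) \<longleftrightarrow>
    (\<exists>\<Omega>A \<Omega>. \<Omega>R = \<Omega>A @ \<Omega> \<and> ctx_geq \<Omega>A (mode A) \<and> der \<Omega>A A \<and>
      (\<forall>y. y \<notin> vars (\<Omega>L @ \<Omega>R) \<longrightarrow> der (\<Omega>L @ [(y, B)] @ \<Omega>) C))"
| "left_premises \<Omega>L \<Omega>R C (With A B) \<longleftrightarrow>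
    (\<forall>y. y \<notin> vars (\<Omega>L @ \<Omega>R) \<longrightarrow> der (\<Omega>L @ [(y, A)] @ \<Omega>R) C) \<or>
    (\<forall>y. y \<notin> vars (\<Omega>L @ \<Omega>R) \<longrightarrow> der (\<Omega>L @ [(y, B)] @ \<Omega>R) C)"
| "left_premises \<Omega>L \<Omega>R C (Up m A) \<longleftrightarrow> mode C \<le> mode A \<and>
    (\<forall>y. y \<notin> vars (\<Omega>L @ \<Omega>R) \<longrightarrow> der (\<Omega>L @ [(y, A)] @ \<Omega>R) C)"
| "left_premises \<Omega>L \<Omega>R C (Fuse A B) \<longleftrightarrow>
    (\<forall>x y. x \<noteq> y \<longrightarrow> x \<notin> vars (\<Omega>L @ \<Omega>R) \<longrightarrow> y \<notin> vars (\<Omega>L @ \<Omega>R) \<longrightarrow>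
      der (\<Omega>L @ [(x, A), (y, B)] @ \<Omega>R) C)"
| "left_premises \<Omega>L \<Omega>R C (One m) \<longleftrightarrow> der (\<Omega>L @ \<Omega>R) C"
| "left_premises \<Omega>L \<Omega>R C (Plus A B) \<longleftrightarrow>
    (\<forall>y. y \<notin> vars (\<Omega>L @ \<Omega>R) \<longrightarrow>
      der (\<Omega>L @ [(y, A)] @ \<Omega>R) C \<and> der (\<Omega>L @ [(y, B)] @ \<Omega>R) C)"
| "left_premises \<Omega>L \<Omega>R C (Down m A) \<longleftrightarrow>
    (\<forall>y. y \<notin> vars (\<Omega>L @ \<Omega>R) \<longrightarrow> der (\<Omega>L @ [(y, A)] @ \<Omega>R) C)"

text \<open>Supplies the split of the left context. Names fresh for the whole conclusion are in
  particular fresh for the side contexts of the main premise.\<close>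

lemma left_premises_LImpI:
  assumes "ctx_geq \<Omega>A (mode A)" and "der \<Omega>A A"
    and "\<And>y. y \<notin> vars (\<Omega>L @ \<Omega>R) \<Longrightarrow> der (\<Omega>L @ [(y, B)] @ \<Omega>R) C"
  shows "left_premises (\<Omega>L @ \<Omega>A) \<Omega>R C (LImp A B)"
proof -
  have "der (\<Omega>L @ [(y, B)] @ \<Omega>R) C" if "y \<notin> vars ((\<Omega>L @ \<Omega>A) @ \<Omega>R)" for y
    using that by (intro assms(3)) auto
  then show ?thesis
    unfolding left_premises.simps using assms(1,2) by (intro exI[of _ \<Omega>L] exI[of _ \<Omega>A]) simp
qed

lemma left_premises_RImpI:
  assumes "ctx_geq \<Omega>A (mode A)" and "der \<Omega>A A"
    and "\<And>y. y \<notin> vars (\<Omega>L @ \<Omega>R) \<Longrightarrow> der (\<Omega>L @ [(y, B)] @ \<Omega>R) C"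
  shows "left_premises \<Omega>L (\<Omega>A @ \<Omega>R) C (RImp A B)"
proof -
  have "der (\<Omega>L @ [(y, B)] @ \<Omega>R) C" if "y \<notin> vars (\<Omega>L @ \<Omega>A @ \<Omega>R)" for y
    using that by (intro assms(3)) auto
  then show ?thesis
    unfolding left_premises.simps using assms(1,2) by (intro exI[of _ \<Omega>A] exI[of _ \<Omega>R]) simp
qed

text \<open>False at atoms, which have no right rule; identity is treated apart from the logical
  rules.\<close>

primrec right_premises :: "('p, 'm) ctx \<Rightarrow> ('p, 'm) formula \<Rightarrow> bool" where
  "right_premises \<Omega> (Atom P m) \<longleftrightarrow> False"
| "right_premises \<Omega> (LImp A B) \<longleftrightarrow> (\<forall>x. x \<notin> vars \<Omega> \<longrightarrow> der ([(x, A)] @ \<Omega>) B)"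
| "right_premises \<Omega> (RImp A B) \<longleftrightarrow> (\<forall>x. x \<notin> vars \<Omega> \<longrightarrow> der (\<Omega> @ [(x, A)]) B)"
| "right_premises \<Omega> (With A B) \<longleftrightarrow> der \<Omega> A \<and> der \<Omega> B"
| "right_premises \<Omega> (Up m A) \<longleftrightarrow> der \<Omega> A"
| "right_premises \<Omega> (Fuse A B) \<longleftrightarrow> (\<exists>\<Omega>1 \<Omega>2. \<Omega> = \<Omega>1 @ \<Omega>2 \<and> der \<Omega>1 A \<and> der \<Omega>2 B)"
| "right_premises \<Omega> (One m) \<longleftrightarrow> \<Omega> = []"
| "right_premises \<Omega> (Plus A B) \<longleftrightarrow> der \<Omega> A \<or> der \<Omega> B"
| "right_premises \<Omega> (Down m A) \<longleftrightarrow> ctx_geq \<Omega> (mode A) \<and> der \<Omega> A"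

text \<open>Any name fresh for the conclusion is a legitimate eigenvariable, so one choice
  instantiates the quantifiers in the premises.\<close>

lemma der_left_rule:
  assumes prem: "left_premises \<Omega>L \<Omega>R C A" and seq: "is_sequent (\<Omega>L @ [(x, A)] @ \<Omega>R \<turnstile> C)"
  shows "der (\<Omega>L @ [(x, A)] @ \<Omega>R) C"
proof -
  obtain y where y: "y \<notin> vars (\<Omega>L @ [(x, A)] @ \<Omega>R)"
    using ex_fresh by blast
  \<comment> \<open>A second eigenvariable for \<open>Fuse\<close>; listing \<open>(y, A)\<close>
    makes it differ from \<open>y\<close>.\<close>
  obtain z where z: "z \<notin> vars ((y, A) # \<Omega>L @ [(x, A)] @ \<Omega>R)"
    using ex_fresh by blast
  show ?thesis
  proof (cases A)
    case (LImp A1 A2)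
    then obtain \<Omega> \<Omega>A where *: "\<Omega>L = \<Omega> @ \<Omega>A" "ctx_geq \<Omega>A (mode A1)" "der \<Omega>A A1"
        "der (\<Omega> @ [(y, A2)] @ \<Omega>R) C"
      using prem y unfolding LImp left_premises.simps by force
    have "der (\<Omega> @ \<Omega>A @ [(x, LImp A1 A2)] @ \<Omega>R) C"
      by (rule derI[OF LImpL]) (use * y seq in \<open>auto simp: LImp\<close>)
    then show ?thesis
      by (simp add: * LImp)
  next
    case (RImp A1 A2)
    then obtain \<Omega> \<Omega>A where *: "\<Omega>R = \<Omega>A @ \<Omega>" "ctx_geq \<Omega>A (mode A1)" "der \<Omega>A A1"
        "der (\<Omega>L @ [(y, A2)] @ \<Omega>) C"
      using prem y by auto
    have "der (\<Omega>L @ [(x, RImp A1 A2)] @ \<Omega>A @ \<Omega>) C"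
      by (rule derI[OF RImpL]) (use * y seq in \<open>auto simp: RImp\<close>)
    then show ?thesis
      by (simp add: * RImp)
  next
    case (With A1 A2)
    then consider "der (\<Omega>L @ [(y, A1)] @ \<Omega>R) C" | "der (\<Omega>L @ [(y, A2)] @ \<Omega>R) C"
      using prem y by auto
    then show ?thesis
    proof cases
      case 1
      then show ?thesis
        unfolding With by (intro derI[OF WithL1[of y]]) (use y seq With in auto)
    next
      case 2
      then show ?thesis
        unfolding With by (intro derI[OF WithL2[of y]]) (use y seq With in auto)
    qed
  next
    case (Up m A1)
    show ?thesis
      unfolding Up
      by (rule derI[OF UpL[of _ _ y]]) (use prem y seq in \<open>auto simp: Up\<close>)
  next
    case (Fuse A1 A2)
    show ?thesis
      unfolding Fuse
      by (rule derI[OF FuseL[of y z]]) (use prem y z seq in \<open>auto simp: Fuse\<close>)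
  next
    case (One m)
    show ?thesis
      unfolding One
      by (rule derI[OF OneL]) (use prem seq in \<open>auto simp: One\<close>)
  next
    case (Plus A1 A2)
    show ?thesis
      unfolding Plus
      by (rule derI[OF PlusL[of y]]) (use prem y seq in \<open>auto simp: Plus\<close>)
  next
    case (Down m A1)
    show ?thesis
      unfolding Down
      by (rule derI[OF DownL[of y]]) (use prem y seq in \<open>auto simp: Down\<close>)
  qed (use prem in simp)
qed

lemma der_right_rule:
  assumes prem: "right_premises \<Omega> A" and seq: "is_sequent (\<Omega> \<turnstile> A)"
  shows "der \<Omega> A"
proof -
  obtain y where y: "y \<notin> vars \<Omega>"
    using ex_fresh by blast
  show ?thesis
  proof (cases A)
    case (LImp A1 A2)
    show ?thesis
      unfolding LImp
      by (rule derI[OF LImpR[of y]]) (use prem y seq in \<open>auto simp: LImp\<close>)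
  next
    case (RImp A1 A2)
    show ?thesis
      unfolding RImp
      by (rule derI[OF RImpR[of y]]) (use prem y seq in \<open>auto simp: RImp\<close>)
  next
    case (With A1 A2)
    show ?thesis
      unfolding With
      by (rule derI[OF WithR]) (use prem seq in \<open>auto simp: With\<close>)
  next
    case (Up m A1)
    show ?thesis
      unfolding Up
      by (rule derI[OF UpR]) (use prem seq in \<open>auto simp: Up\<close>)
  next
    case (Fuse A1 A2)
    then obtain \<Omega>1 \<Omega>2 where *: "\<Omega> = \<Omega>1 @ \<Omega>2" "der \<Omega>1 A1" "der \<Omega>2 A2"
      using prem by auto
    show ?thesis
      unfolding Fuse *(1)
      by (rule derI[OF FuseR]) (use * seq in \<open>auto simp: Fuse\<close>)
  next
    case (One m)
    then show ?thesis
      using prem seq derI[OF OneR] by simp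
  next
    case (Plus A1 A2)
    then consider "der \<Omega> A1" | "der \<Omega> A2"
      using prem by auto
    then show ?thesis
    proof cases
      case 1
      then show ?thesis
        unfolding Plus by (intro derI[OF PlusR1]) (use seq Plus in auto)
    next
      case 2
      then show ?thesis
        unfolding Plus by (intro derI[OF PlusR2]) (use seq Plus in auto)
    qed
  next
    case (Down m A1)
    show ?thesis
      unfolding Down
      by (rule derI[OF DownR]) (use prem seq in \<open>auto simp: Down\<close>)
  qed (use prem in simp)
qed

subsection \<open>Substitution into the second derivation\<close>

text \<open>\<open>usable \<Delta> A\<close> is the principal case of the cut: \<open>\<Delta>\<close> can stand in for a hypothesis \<open>A\<close> that
  is about to be decomposed.\<close>

definition usable :: "('p, 'm) ctx \<Rightarrow> ('p, 'm) formula \<Rightarrow> bool" where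
  "usable \<Delta> A \<longleftrightarrow> (\<forall>\<Omega>L \<Omega>R C. mode C \<le> mode A \<longrightarrow> left_premises \<Omega>L \<Omega>R C A \<longrightarrow>
     is_sequent (\<Omega>L @ \<Delta> @ \<Omega>R \<turnstile> C) \<longrightarrow> der (\<Omega>L @ \<Delta> @ \<Omega>R) C)"

abbreviation substitutable :: "(var \<times> ('p, 'm) formula \<Rightarrow> ('p, 'm) ctx) \<Rightarrow> ('p, 'm) ctx \<Rightarrow> bool" where
  "substitutable \<theta> \<Omega> \<equiv> \<forall>b \<in> set \<Omega>. der (\<theta> b) (snd b) \<and> usable (\<theta> b) (snd b)"

text \<open>If the block is itself an antecedent \<open>A\<close>, the left rule applies
  unchanged.\<close>

lemma usable_var: "usable [(x, A)] A"
  unfolding usable_def using der_left_rule by blast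

lemma substitutable_var:
  "ordered_context \<Omega> \<Longrightarrow> b \<in> set \<Omega> \<Longrightarrow> der [b] (snd b) \<and> usable [b] (snd b)"
  by (cases b) (auto simp: ordered_context_def der_Id usable_var)

text \<open>Each inference is repeated on the substituted context: identity becomes the given
  derivation of the block, right rules are reapplied, structural rules act on whole blocks, and a
  left rule is taken over by \<open>usable\<close> of its principal antecedent.\<close>

theorem der_subst:
  assumes "der \<Omega> C" and "substitutable \<theta> \<Omega>" and "ordered_context (concat (map \<theta> \<Omega>))"
  shows "der (concat (map \<theta> \<Omega>)) C"
  using assms
proof (induction arbitrary: \<theta> rule: der_induct)
  case (step ps \<Omega> C)
  let ?s = "\<lambda>\<Omega>. concat (map \<theta> \<Omega>)"
  note subst = step.prems(1) and ord = step.prems(2)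
  \<comment> \<open>A block derives the proposition that it replaces, so its modes lie above the
    mode of that proposition.\<close>
  have geq: "ctx_geq (?s \<Omega>') m" if "\<forall>b \<in> set \<Omega>'. b \<in> set \<Omega>" "ctx_geq \<Omega>' m" for \<Omega>' m
    using that subst derD(3) by (intro ctx_geq_concat) blast+
  have seq: "is_sequent (?s \<Omega> \<turnstile> C)"
    using step.hyps(2) ord geq[of \<Omega>] by auto
  \<comment> \<open>Premises without eigenvariables keep the substitution
    \<open>\<theta>\<close>.\<close>
  have sub: "der (?s \<Omega>') C'" if "(\<Omega>' \<turnstile> C') \<in> set ps" "\<forall>b \<in> set \<Omega>'. b \<in> set \<Omega>" for \<Omega>' C'
  proof (rule step.IH[OF that(1)])
    show "substitutable \<theta> \<Omega>'"
      using subst that(2) by blast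
    show "ordered_context (?s \<Omega>')"
      using ord by (rule ordered_context_mono) (use that(2) in auto)
  qed
  \<comment> \<open>The eigenvariable \<open>y\<close> is sent to a variable \<open>y'\<close>,
    arbitrary up to freshness; this yields the quantified premises of the logical rules.\<close>
  have fresh: "der (?s \<Omega>1 @ [(y', B)] @ ?s \<Omega>2) C'"
    if "(\<Omega>1 @ [(y, B)] @ \<Omega>2 \<turnstile> C') \<in> set ps" "\<forall>b \<in> set (\<Omega>1 @ \<Omega>2). b \<in> set \<Omega>" "y \<notin> vars \<Omega>"
      "y' \<notin> vars (?s (\<Omega>1 @ \<Omega>2))" for \<Omega>1 \<Omega>2 y y' B C'
  proof -
    let ?\<theta> = "\<theta>((y, B) := [(y', B)])"
    have y: "y \<notin> vars \<Omega>1" "y \<notin> vars \<Omega>2"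
      using that(2,3) by auto
    have wf: "wf_prop B"
      using derD(1)[OF step.hyps(3)[OF that(1)]] by (simp add: ordered_context_def)
    have eq: "concat (map ?\<theta> (\<Omega>1 @ [(y, B)] @ \<Omega>2)) = ?s \<Omega>1 @ [(y', B)] @ ?s \<Omega>2"
      using y by (simp add: map_update_fresh image_Un)
    have "ordered_context (?s (\<Omega>1 @ \<Omega>2))"
      using ord by (rule ordered_context_mono) (use that(2) in auto)
    then have "ordered_context (?s \<Omega>1 @ [(y', B)] @ ?s \<Omega>2)"
      by (rule ordered_context_fresh[where y=y' and B=B]) (use that wf in auto)
    moreover have "substitutable ?\<theta> (\<Omega>1 @ [(y, B)] @ \<Omega>2)"
      using subst that(2) wf by (auto simp: der_Id usable_var)
    ultimately show ?thesis
      using step.IH[OF that(1), of ?\<theta>] unfolding eq by blast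
  qed
  \<comment> \<open>The side contexts are already substituted; \<open>usable\<close> then puts the
    block in the place of the principal antecedent.\<close>
  have left: "der (?s \<Omega>L @ \<theta> (x, A) @ ?s \<Omega>R) C"
    if "\<Omega> = \<Omega>L @ [(x, A)] @ \<Omega>R" "left_premises (?s \<Omega>L) (?s \<Omega>R) C A" for \<Omega>L \<Omega>R x A
    using subst step.hyps(2) seq that unfolding usable_def by simp
  have block: "ctx_geq (\<theta> (x, A)) (mode A)" if "(x, A) \<in> set \<Omega>" for x A
    using subst that derD(3) by fastforce
  from step.hyps(1) show ?case
  proof cases
    case (Id x)
    then show ?thesis
      using subst by simp
  next
    case (OneR m)
    then show ?thesis
      using seq derI[OF inference.OneR] by simp
  next
    case (OneL \<Omega>L \<Omega>R x m)
    then show ?thesis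
      using left[of \<Omega>L x "One m" \<Omega>R] sub[of "\<Omega>L @ \<Omega>R" C] by auto
  next
    case (FuseR \<Omega>1 A \<Omega>2 B)
    then show ?thesis
      using sub[of \<Omega>1 A] sub[of \<Omega>2 B] seq by (intro der_right_rule) auto
  next
    case (FuseL x1 x2 \<Omega>L x A B \<Omega>R)
    \<comment> \<open>Two eigenvariables appear at once, which \<open>fresh\<close> does not cover;
      they are added to the context one after the other.\<close>
    have "der (?s \<Omega>L @ [(z1, A), (z2, B)] @ ?s \<Omega>R) C"
      if z: "z1 \<noteq> z2" "z1 \<notin> vars (?s \<Omega>L @ ?s \<Omega>R)" "z2 \<notin> vars (?s \<Omega>L @ ?s \<Omega>R)" for z1 z2
    proof -
      let ?\<theta> = "\<theta>((x1, A) := [(z1, A)], (x2, B) := [(z2, B)])"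
      have prem: "(\<Omega>L @ [(x1, A), (x2, B)] @ \<Omega>R \<turnstile> C) \<in> set ps"
        using FuseL by simp
      have wf: "wf_prop A" "wf_prop B"
        using derD(1)[OF step.hyps(3)[OF prem]] by (simp_all add: ordered_context_def)
      have eq: "concat (map ?\<theta> (\<Omega>L @ [(x1, A), (x2, B)] @ \<Omega>R)) = ?s \<Omega>L @ [(z1, A), (z2, B)] @ ?s \<Omega>R"
        using FuseL by (simp add: map_update_fresh image_Un)
      have "ordered_context (?s (\<Omega>L @ \<Omega>R))"
        using ord by (rule ordered_context_mono) (use FuseL in auto)
      then have "ordered_context ((z1, A) # ?s (\<Omega>L @ \<Omega>R))"
        by (rule ordered_context_fresh[where y=z1 and B=A]) (use z wf in auto)
      then have "ordered_context (?s \<Omega>L @ [(z1, A), (z2, B)] @ ?s \<Omega>R)"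
        by (rule ordered_context_fresh[where y=z2 and B=B]) (use z wf in auto)
      moreover have "substitutable ?\<theta> (\<Omega>L @ [(x1, A), (x2, B)] @ \<Omega>R)"
        using subst wf FuseL by (auto simp: der_Id usable_var)
      ultimately show ?thesis
        using step.IH[OF prem, of ?\<theta>] unfolding eq by blast
    qed
    then show ?thesis
      using left[of \<Omega>L x "Fuse A B" \<Omega>R] FuseL by simp
  next
    case (PlusR1 A B)
    then show ?thesis
      using sub[of \<Omega> A] seq by (intro der_right_rule) auto
  next
    case (PlusR2 B A)
    then show ?thesis
      using sub[of \<Omega> B] seq by (intro der_right_rule) auto
  next
    case (PlusL y \<Omega>L x A B \<Omega>R)
    then show ?thesis
      using left[of \<Omega>L x "Plus A B" \<Omega>R] fresh[of \<Omega>L y A \<Omega>R C] fresh[of \<Omega>L y B \<Omega>R C] by auto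
  next
    case (DownR A m)
    then show ?thesis
      using sub[of \<Omega> A] seq geq[of \<Omega> "mode A"] by (intro der_right_rule) auto
  next
    case (DownL y \<Omega>L x m A \<Omega>R)
    then show ?thesis
      using left[of \<Omega>L x "Down m A" \<Omega>R] fresh[of \<Omega>L y A \<Omega>R C] by auto
  next
    case (RImpR x A B)
    then show ?thesis
      using fresh[of \<Omega> x A "[]" B] seq by (intro der_right_rule) auto
  next
    case (RImpL \<Omega>A A y \<Omega>L f B \<Omega>R)
    have "left_premises (?s \<Omega>L) (?s \<Omega>A @ ?s \<Omega>R) C (RImp A B)"
    proof (rule left_premises_RImpI)
      show "der (?s \<Omega>L @ [(z, B)] @ ?s \<Omega>R) C" if "z \<notin> vars (?s \<Omega>L @ ?s \<Omega>R)" for z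
        using fresh[of \<Omega>L y B \<Omega>R C z] RImpL that by auto
    qed (use RImpL sub[of \<Omega>A A] geq[of \<Omega>A "mode A"] in simp_all)
    then show ?thesis
      using left[of \<Omega>L f "RImp A B" "\<Omega>A @ \<Omega>R"] RImpL by simp
  next
    case (LImpR x A B)
    then show ?thesis
      using fresh[of "[]" x A \<Omega> B] seq by (intro der_right_rule) auto
  next
    case (LImpL \<Omega>A A y \<Omega>L f B \<Omega>R)
    have "left_premises (?s \<Omega>L @ ?s \<Omega>A) (?s \<Omega>R) C (LImp A B)"
    proof (rule left_premises_LImpI)
      show "der (?s \<Omega>L @ [(z, B)] @ ?s \<Omega>R) C" if "z \<notin> vars (?s \<Omega>L @ ?s \<Omega>R)" for z
        using fresh[of \<Omega>L y B \<Omega>R C z] LImpL that by auto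
    qed (use LImpL sub[of \<Omega>A A] geq[of \<Omega>A "mode A"] in simp_all)
    then show ?thesis
      using left[of "\<Omega>L @ \<Omega>A" f "LImp A B" \<Omega>R] LImpL by simp
  next
    case (WithR A B)
    then show ?thesis
      using sub[of \<Omega> A] sub[of \<Omega> B] seq by (intro der_right_rule) auto
  next
    case (WithL1 y \<Omega>L x A B \<Omega>R)
    then show ?thesis
      using left[of \<Omega>L x "With A B" \<Omega>R] fresh[of \<Omega>L y A \<Omega>R C] by auto
  next
    case (WithL2 y \<Omega>L x A B \<Omega>R)
    then show ?thesis
      using left[of \<Omega>L x "With A B" \<Omega>R] fresh[of \<Omega>L y B \<Omega>R C] by auto
  next
    case (UpR A m)
    then show ?thesis
      using sub[of \<Omega> A] seq by (intro der_right_rule) auto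
  next
    case (UpL A y \<Omega>L x m \<Omega>R)
    then show ?thesis
      using left[of \<Omega>L x "Up m A" \<Omega>R] fresh[of \<Omega>L y A \<Omega>R C] by auto
  next
    case (MoveL A \<Omega>L \<Omega>M x \<Omega>R)
    then have "der (?s \<Omega>L @ ?s \<Omega>M @ \<theta> (x, A) @ ?s \<Omega>R) C"
      using sub[of "\<Omega>L @ \<Omega>M @ [(x, A)] @ \<Omega>R" C] by simp
    from der_move_left_block[OF this MoveL(3) block] show ?thesis
      by (simp add: MoveL)
  next
    case (MoveR A \<Omega>L x \<Omega>M \<Omega>R)
    then have "der (?s \<Omega>L @ \<theta> (x, A) @ ?s \<Omega>M @ ?s \<Omega>R) C"
      using sub[of "\<Omega>L @ [(x, A)] @ \<Omega>M @ \<Omega>R" C] by simp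
    from der_move_right_block[OF this MoveR(3) block] show ?thesis
      by (simp add: MoveR)
  next
    case (ContractL A \<Omega>L x \<Omega>M \<Omega>R)
    then have "der (?s \<Omega>L @ \<theta> (x, A) @ ?s \<Omega>M @ \<theta> (x, A) @ ?s \<Omega>R) C"
      using sub[of "\<Omega>L @ [(x, A)] @ \<Omega>M @ [(x, A)] @ \<Omega>R" C] by simp
    \<comment> \<open>Both occurrences are the same antecedent and so have the same image, which
      makes the two blocks contractible.\<close>
    from der_contract_left_block[OF this subset_refl ContractL(3) block] show ?thesis
      by (simp add: ContractL)
  next
    case (ContractR A \<Omega>L x \<Omega>M \<Omega>R)
    then have "der (?s \<Omega>L @ \<theta> (x, A) @ ?s \<Omega>M @ \<theta> (x, A) @ ?s \<Omega>R) C"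
      using sub[of "\<Omega>L @ [(x, A)] @ \<Omega>M @ [(x, A)] @ \<Omega>R" C] by simp
    from der_contract_right_block[OF this subset_refl ContractR(3) block] show ?thesis
      by (simp add: ContractR)
  next
    case (Weaken A \<Omega>L \<Omega>R x)
    then have "der (?s \<Omega>L @ ?s \<Omega>R) C"
      using sub[of "\<Omega>L @ \<Omega>R" C] by simp
    moreover have "is_sequent (?s \<Omega>L @ \<theta> (x, A) @ ?s \<Omega>R \<turnstile> C)"
      using seq by (simp add: Weaken)
    ultimately have "der (?s \<Omega>L @ \<theta> (x, A) @ ?s \<Omega>R) C"
      using Weaken(3) block by (rule der_weaken_block) (simp add: Weaken)
    then show ?thesis
      by (simp add: Weaken)
  qed
qed

text \<open>Renaming is the substitution of single variables. \<open>f\<close> may identify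
  variables as long as the renamed context labels each variable consistently.\<close>

corollary der_rename:
  assumes "der \<Omega> C" and "ordered_context (map (apfst f) \<Omega>)"
  shows "der (map (apfst f) \<Omega>) C"
proof -
  have eq: "concat (map (\<lambda>b. [apfst f b]) \<Omega>) = map (apfst f) \<Omega>"
    by (induction \<Omega>) auto
  have "substitutable (\<lambda>b. [apfst f b]) \<Omega>"
    using derD(1)[OF assms(1)] by (auto simp: ordered_context_def der_Id usable_var)
  from der_subst[OF assms(1) this] show ?thesis
    using assms(2) by (simp add: eq)
qed

text \<open>Freshness of \<open>x\<close> leaves a single occurrence to replace; every other
  antecedent is sent to itself.\<close>

corollary der_cut1:
  assumes "der \<Delta> A" and "usable \<Delta> A" and "der (\<Omega>L @ [(x, A)] @ \<Omega>R) C"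
    and "x \<notin> vars (\<Omega>L @ \<Omega>R)" and "ordered_context (\<Omega>L @ \<Delta> @ \<Omega>R)"
  shows "der (\<Omega>L @ \<Delta> @ \<Omega>R) C"
proof -
  let ?\<theta> = "(\<lambda>b. [b])((x, A) := \<Delta>)"
  have eq: "concat (map ?\<theta> (\<Omega>L @ [(x, A)] @ \<Omega>R)) = \<Omega>L @ \<Delta> @ \<Omega>R"
    using assms(4) by (simp add: map_update_fresh image_Un)
  have "substitutable ?\<theta> (\<Omega>L @ [(x, A)] @ \<Omega>R)"
    using assms(1,2) substitutable_var[OF derD(1)[OF assms(3)]] by simp
  from der_subst[OF assms(3) this] show ?thesis
    using assms(5) unfolding eq by blast
qed

subsection \<open>Principal cuts\<close>

text \<open>
  The renaming \<open>f\<close> keeps the eigenvariables of the derivation of \<open>A\<close> apart from the surrounding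
  context.
\<close>

lemma der_left_commute:
  assumes "der \<Delta> A" and "mode C \<le> mode A"
    and var: "\<And>z. is_sequent (\<Omega>L @ [(z, A)] @ \<Omega>R \<turnstile> C) \<Longrightarrow> der (\<Omega>L @ [(z, A)] @ \<Omega>R) C"
    and right: "\<And>\<Delta>. right_premises \<Delta> A \<Longrightarrow> is_sequent (\<Omega>L @ \<Delta> @ \<Omega>R \<turnstile> C) \<Longrightarrow> der (\<Omega>L @ \<Delta> @ \<Omega>R) C"
    and "is_sequent (\<Omega>L @ map (apfst f) \<Delta> @ \<Omega>R \<turnstile> C)"
  shows "der (\<Omega>L @ map (apfst f) \<Delta> @ \<Omega>R) C"
  using assms
proof (induction arbitrary: f rule: der_induct)
  case (step ps \<Delta> A)
  let ?r = "map (apfst f)"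
  note le = step.prems(1) and var = step.prems(2) and right = step.prems(3) and seq = step.prems(4)
  have ord: "ordered_context (\<Omega>L @ ?r \<Delta> @ \<Omega>R)"
    using seq by simp
  then have ordA: "ordered_context (?r \<Delta>)"
    by (rule ordered_context_mono) auto
  \<comment> \<open>The cut moves up into a premise without new variables. A context above the mode
    of \<open>A\<close> is also above that of \<open>C\<close>.\<close>
  have sub: "der (\<Omega>L @ ?r \<Delta>' @ \<Omega>R) C" if "(\<Delta>' \<turnstile> A) \<in> set ps" "\<forall>b \<in> set \<Delta>'. b \<in> set \<Delta>" for \<Delta>'
  proof (rule step.IH[OF that(1) le var right])
    have "ctx_geq \<Delta>' (mode C)"
      using derD(3)[OF step.hyps(3)[OF that(1)]] le by (rule ctx_geq_trans)
    moreover have "set (\<Omega>L @ ?r \<Delta>' @ \<Omega>R) \<subseteq> set (\<Omega>L @ ?r \<Delta> @ \<Omega>R)"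
      using that(2) by auto
    ultimately show "is_sequent (\<Omega>L @ ?r \<Delta>' @ \<Omega>R \<turnstile> C)"
      using seq ordered_context_mono[OF ord, of "\<Omega>L @ ?r \<Delta>' @ \<Omega>R"] by auto
  qed
  \<comment> \<open>Premises of right rules and argument premises of implications are not cut but
    only renamed.\<close>
  have ren: "der (?r \<Delta>') B" if "(\<Delta>' \<turnstile> B) \<in> set ps" "\<forall>b \<in> set \<Delta>'. b \<in> set \<Delta>" for \<Delta>' B
  proof (rule der_rename[OF step.hyps(3)[OF that(1)]])
    have "set (?r \<Delta>') \<subseteq> set (?r \<Delta>)"
      using that(2) by auto
    then show "ordered_context (?r \<Delta>')"
      using ordered_context_mono[OF ordA] by blast
  qed
  have ren_fresh: "der (?r \<Delta>1 @ [(y', B)] @ ?r \<Delta>2) D"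
    if "(\<Delta>1 @ [(y, B)] @ \<Delta>2 \<turnstile> D) \<in> set ps" "\<forall>b \<in> set (\<Delta>1 @ \<Delta>2). b \<in> set \<Delta>" "y \<notin> vars \<Delta>"
      "y' \<notin> vars (?r (\<Delta>1 @ \<Delta>2))" for \<Delta>1 \<Delta>2 y y' B D
  proof -
    have y: "y \<notin> vars \<Delta>1" "y \<notin> vars \<Delta>2"
      using that(2,3) by auto
    have wf: "wf_prop B"
      using derD(1)[OF step.hyps(3)[OF that(1)]] by (simp add: ordered_context_def)
    have eq: "map (apfst (f(y := y'))) (\<Delta>1 @ [(y, B)] @ \<Delta>2) = ?r \<Delta>1 @ [(y', B)] @ ?r \<Delta>2"
      using y by (simp add: rename_update_fresh image_Un)
    have "set (?r (\<Delta>1 @ \<Delta>2)) \<subseteq> set (?r \<Delta>)"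
      using that(2) by auto
    then have "ordered_context (?r (\<Delta>1 @ \<Delta>2))"
      using ordered_context_mono[OF ordA] by blast
    then have "ordered_context (?r \<Delta>1 @ [(y', B)] @ ?r \<Delta>2)"
      by (rule ordered_context_fresh[where y=y' and B=B]) (use that wf in auto)
    then show ?thesis
      using der_rename[OF step.hyps(3)[OF that(1)], of "f(y := y')"] unfolding eq by blast
  qed
  \<comment> \<open>The eigenvariable has to avoid \<open>\<Omega>L\<close> and
    \<open>\<Omega>R\<close> as well; updating the renaming at \<open>y\<close> moves it to such a
    name.\<close>
  have fresh: "der ((\<Omega>L @ ?r \<Delta>1) @ [(y', B)] @ (?r \<Delta>2 @ \<Omega>R)) C"
    if "(\<Delta>1 @ [(y, B)] @ \<Delta>2 \<turnstile> A) \<in> set ps" "\<forall>b \<in> set (\<Delta>1 @ \<Delta>2). b \<in> set \<Delta>" "y \<notin> vars \<Delta>"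
      "y' \<notin> vars ((\<Omega>L @ ?r \<Delta>1) @ (?r \<Delta>2 @ \<Omega>R))" for \<Delta>1 \<Delta>2 y y' B
  proof -
    have y: "y \<notin> vars \<Delta>1" "y \<notin> vars \<Delta>2"
      using that(2,3) by auto
    note prem = derD[OF step.hyps(3)[OF that(1)]]
    have wf: "wf_prop B"
      using prem(1) by (simp add: ordered_context_def)
    have eq: "map (apfst (f(y := y'))) (\<Delta>1 @ [(y, B)] @ \<Delta>2) = ?r \<Delta>1 @ [(y', B)] @ ?r \<Delta>2"
      using y by (simp add: rename_update_fresh image_Un)
    have "set (\<Omega>L @ ?r (\<Delta>1 @ \<Delta>2) @ \<Omega>R) \<subseteq> set (\<Omega>L @ ?r \<Delta> @ \<Omega>R)"
      using that(2) by auto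
    then have "ordered_context (\<Omega>L @ ?r (\<Delta>1 @ \<Delta>2) @ \<Omega>R)"
      using ordered_context_mono[OF ord] by blast
    then have "ordered_context (\<Omega>L @ (?r \<Delta>1 @ [(y', B)] @ ?r \<Delta>2) @ \<Omega>R)"
      by (rule ordered_context_fresh[where y=y' and B=B]) (use that wf in auto)
    moreover have "ctx_geq (\<Delta>1 @ [(y, B)] @ \<Delta>2) (mode C)"
      using prem(3) le by (rule ctx_geq_trans)
    ultimately have "is_sequent (\<Omega>L @ (?r \<Delta>1 @ [(y', B)] @ ?r \<Delta>2) @ \<Omega>R \<turnstile> C)"
      using seq by auto
    then show ?thesis
      using step.IH[OF that(1) le var right, of "f(y := y')"] unfolding eq by simp
  qed
  \<comment> \<open>The left rule is reapplied below the cut, inside the larger context.\<close>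
  have left: "der (\<Omega>L @ ?r \<Delta>1 @ [(f x, B)] @ ?r \<Delta>2 @ \<Omega>R) C"
    if "\<Delta> = \<Delta>1 @ [(x, B)] @ \<Delta>2" "left_premises (\<Omega>L @ ?r \<Delta>1) (?r \<Delta>2 @ \<Omega>R) C B" for \<Delta>1 \<Delta>2 x B
    using der_left_rule[OF that(2), of "f x"] seq that(1) by simp
  have right': "der (\<Omega>L @ ?r \<Delta> @ \<Omega>R) C" if "right_premises (?r \<Delta>) A"
    using right[OF that seq] .
  from step.hyps(1) show ?case
  proof cases
    \<comment> \<open>The block is the single variable \<open>f x\<close>, so the cut only renames
      the hypothesis.\<close>
    case (Id x)
    then show ?thesis
      using var[of "f x"] seq by simp
  next
    case (OneR m)
    then show ?thesis
      using right' by simp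
  next
    case (OneL \<Delta>1 \<Delta>2 x m)
    then show ?thesis
      using left[of \<Delta>1 x "One m" \<Delta>2] sub[of "\<Delta>1 @ \<Delta>2"] by auto
  next
    case (FuseR \<Delta>1 A1 \<Delta>2 A2)
    then show ?thesis
      using right' ren[of \<Delta>1 A1] ren[of \<Delta>2 A2] by auto
  next
    case (FuseL x1 x2 \<Delta>1 x B D \<Delta>2)
    have "der ((\<Omega>L @ ?r \<Delta>1) @ [(z1, B), (z2, D)] @ (?r \<Delta>2 @ \<Omega>R)) C"
      if z: "z1 \<noteq> z2" "z1 \<notin> vars ((\<Omega>L @ ?r \<Delta>1) @ ?r \<Delta>2 @ \<Omega>R)"
        "z2 \<notin> vars ((\<Omega>L @ ?r \<Delta>1) @ ?r \<Delta>2 @ \<Omega>R)" for z1 z2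
    proof -
      let ?f = "f(x1 := z1, x2 := z2)"
      let ?\<Delta> = "\<Delta>1 @ [(x1, B), (x2, D)] @ \<Delta>2"
      have mem: "(?\<Delta> \<turnstile> A) \<in> set ps"
        using FuseL by simp
      note prem = derD[OF step.hyps(3)[OF mem]]
      have wf: "wf_prop B" "wf_prop D"
        using prem(1) by (simp_all add: ordered_context_def)
      have eq: "map (apfst ?f) ?\<Delta> = ?r \<Delta>1 @ [(z1, B), (z2, D)] @ ?r \<Delta>2"
        using FuseL by (simp add: rename_update_fresh image_Un)
      have "ordered_context (\<Omega>L @ ?r (\<Delta>1 @ \<Delta>2) @ \<Omega>R)"
        by (rule ordered_context_mono[OF ord]) (auto simp: FuseL(2))
      then have "ordered_context ((z1, B) # \<Omega>L @ ?r (\<Delta>1 @ \<Delta>2) @ \<Omega>R)"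
        by (rule ordered_context_fresh[where y=z1 and B=B]) (use z wf in auto)
      then have "ordered_context (\<Omega>L @ (?r \<Delta>1 @ [(z1, B), (z2, D)] @ ?r \<Delta>2) @ \<Omega>R)"
        by (rule ordered_context_fresh[where y=z2 and B=D]) (use z wf in auto)
      moreover have "ctx_geq ?\<Delta> (mode C)"
        using prem(3) le by (rule ctx_geq_trans)
      ultimately have "is_sequent (\<Omega>L @ (?r \<Delta>1 @ [(z1, B), (z2, D)] @ ?r \<Delta>2) @ \<Omega>R \<turnstile> C)"
        using seq by auto
      then show ?thesis
        using step.IH[OF mem le var right, of ?f] unfolding eq by simp
    qed
    then show ?thesis
      using left[of \<Delta>1 x "Fuse B D" \<Delta>2] FuseL by simp
  next
    case (PlusR1 A1 A2)
    then show ?thesis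
      using right' ren[of \<Delta> A1] by auto
  next
    case (PlusR2 A2 A1)
    then show ?thesis
      using right' ren[of \<Delta> A2] by auto
  next
    case (PlusL y \<Delta>1 x B D \<Delta>2)
    then show ?thesis
      using left[of \<Delta>1 x "Plus B D" \<Delta>2] fresh[of \<Delta>1 y B \<Delta>2] fresh[of \<Delta>1 y D \<Delta>2] by auto
  next
    case (DownR A1 m)
    then show ?thesis
      using right' ren[of \<Delta> A1] by auto
  next
    case (DownL y \<Delta>1 x m B \<Delta>2)
    then show ?thesis
      using left[of \<Delta>1 x "Down m B" \<Delta>2] fresh[of \<Delta>1 y B \<Delta>2] by auto
  next
    case (RImpR x A1 A2)
    then show ?thesis
      using right' ren_fresh[of \<Delta> x A1 "[]" A2] by auto
  next
    case (RImpL \<Delta>A B y \<Delta>1 g D \<Delta>2)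
    have "left_premises (\<Omega>L @ ?r \<Delta>1) ((?r \<Delta>A @ ?r \<Delta>2) @ \<Omega>R) C (RImp B D)"
      unfolding append_assoc[of _ _ \<Omega>R]
    proof (rule left_premises_RImpI)
      show "der ((\<Omega>L @ ?r \<Delta>1) @ [(z, D)] @ (?r \<Delta>2 @ \<Omega>R)) C"
        if "z \<notin> vars ((\<Omega>L @ ?r \<Delta>1) @ (?r \<Delta>2 @ \<Omega>R))" for z
        using fresh[of \<Delta>1 y D \<Delta>2 z] RImpL that by auto
    qed (use RImpL ren[of \<Delta>A B] in simp_all)
    then show ?thesis
      using left[of \<Delta>1 g "RImp B D" "\<Delta>A @ \<Delta>2"] RImpL by simp
  next
    case (LImpR x A1 A2)
    then show ?thesis
      using right' ren_fresh[of "[]" x A1 \<Delta> A2] by auto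
  next
    case (LImpL \<Delta>A B y \<Delta>1 g D \<Delta>2)
    have "left_premises (\<Omega>L @ ?r \<Delta>1 @ ?r \<Delta>A) (?r \<Delta>2 @ \<Omega>R) C (LImp B D)"
      unfolding append_assoc[symmetric, of \<Omega>L]
    proof (rule left_premises_LImpI)
      show "der ((\<Omega>L @ ?r \<Delta>1) @ [(z, D)] @ (?r \<Delta>2 @ \<Omega>R)) C"
        if "z \<notin> vars ((\<Omega>L @ ?r \<Delta>1) @ (?r \<Delta>2 @ \<Omega>R))" for z
        using fresh[of \<Delta>1 y D \<Delta>2 z] LImpL that by auto
    qed (use LImpL ren[of \<Delta>A B] in simp_all)
    then show ?thesis
      using left[of "\<Delta>1 @ \<Delta>A" g "LImp B D" \<Delta>2] LImpL by simp
  next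
    case (WithR A1 A2)
    then show ?thesis
      using right' ren[of \<Delta> A1] ren[of \<Delta> A2] by auto
  next
    case (WithL1 y \<Delta>1 x B D \<Delta>2)
    then show ?thesis
      using left[of \<Delta>1 x "With B D" \<Delta>2] fresh[of \<Delta>1 y B \<Delta>2] by auto
  next
    case (WithL2 y \<Delta>1 x B D \<Delta>2)
    then show ?thesis
      using left[of \<Delta>1 x "With B D" \<Delta>2] fresh[of \<Delta>1 y D \<Delta>2] by auto
  next
    case (UpR A1 m)
    then show ?thesis
      using right' ren[of \<Delta> A1] by auto
  next
    \<comment> \<open>The side condition survives the change of succedent:
      \<open>mode C \<le> mode A\<close> and \<open>mode A \<le> mode B\<close>.\<close>
    case (UpL B y \<Delta>1 x m \<Delta>2)
    then show ?thesis
      using left[of \<Delta>1 x "Up m B" \<Delta>2] fresh[of \<Delta>1 y B \<Delta>2] le by (auto intro: order_trans)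
  next
    case (MoveL B \<Delta>1 \<Delta>M x \<Delta>2)
    then show ?thesis
      using sub[of "\<Delta>1 @ \<Delta>M @ [(x, B)] @ \<Delta>2"] seq
        derI[OF inference.MoveL[of \<sigma> B "\<Omega>L @ ?r \<Delta>1" "?r \<Delta>M" "f x" "?r \<Delta>2 @ \<Omega>R" C]] by auto
  next
    case (MoveR B \<Delta>1 x \<Delta>M \<Delta>2)
    then show ?thesis
      using sub[of "\<Delta>1 @ [(x, B)] @ \<Delta>M @ \<Delta>2"] seq
        derI[OF inference.MoveR[of \<sigma> B "\<Omega>L @ ?r \<Delta>1" "f x" "?r \<Delta>M" "?r \<Delta>2 @ \<Omega>R" C]] by auto
  next
    case (ContractL B \<Delta>1 x \<Delta>M \<Delta>2)
    then show ?thesis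
      using sub[of "\<Delta>1 @ [(x, B)] @ \<Delta>M @ [(x, B)] @ \<Delta>2"] seq
        derI[OF inference.ContractL[of \<sigma> B "\<Omega>L @ ?r \<Delta>1" "f x" "?r \<Delta>M" "?r \<Delta>2 @ \<Omega>R" C]] by auto
  next
    case (ContractR B \<Delta>1 x \<Delta>M \<Delta>2)
    then show ?thesis
      using sub[of "\<Delta>1 @ [(x, B)] @ \<Delta>M @ [(x, B)] @ \<Delta>2"] seq
        derI[OF inference.ContractR[of \<sigma> B "\<Omega>L @ ?r \<Delta>1" "f x" "?r \<Delta>M" "?r \<Delta>2 @ \<Omega>R" C]] by auto
  next
    case (Weaken B \<Delta>1 \<Delta>2 x)
    then show ?thesis
      using sub[of "\<Delta>1 @ \<Delta>2"] seq
        derI[OF inference.Weaken[of \<sigma> B "\<Omega>L @ ?r \<Delta>1" "?r \<Delta>2 @ \<Omega>R" C "f x"]] by auto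
  qed
qed

text \<open>By induction on the size of \<open>A\<close>. Commuting past the left and structural
  rules leads to the right rules for \<open>A\<close>; there the premises of the right and the left
  rule meet, and the remaining cuts are on immediate subformulas, where the induction hypothesis
  provides what \<open>der_cut1\<close> asks for.\<close>

theorem usable_if_der:
  fixes A :: "('p, 'm) formula"
  shows "der \<Delta> A \<Longrightarrow> usable \<Delta> A"
proof (induction A arbitrary: \<Delta> rule: measure_induct_rule[where f = size])
  case (less A)
  \<comment> \<open>\<open>\<Omega>\<close> is an ambient context containing all antecedents of the
    conclusion, so one well-formedness fact serves several cuts.\<close>
  have cut: "der (\<Omega>1 @ \<Gamma> @ \<Omega>2) D"
    if "size B < size A" "der \<Gamma> B" "der (\<Omega>1 @ [(y, B)] @ \<Omega>2) D"
      "y \<notin> vars (\<Omega>1 @ \<Omega>2)" "ordered_context \<Omega>" "set (\<Omega>1 @ \<Gamma> @ \<Omega>2) \<subseteq> set \<Omega>"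
    for B D :: "('p, 'm) formula" and \<Gamma> \<Omega> \<Omega>1 \<Omega>2 y
    by (rule der_cut1[OF that(2) less.IH[OF that(1,2)] that(3,4) ordered_context_mono[OF that(5,6)]])
  show ?case
    unfolding usable_def
  proof (intro allI impI)
    fix \<Omega>L \<Omega>R C
    assume le: "mode C \<le> mode A" and prem: "left_premises \<Omega>L \<Omega>R C A"
      and seq: "is_sequent (\<Omega>L @ \<Delta> @ \<Omega>R \<turnstile> C)"
    \<comment> \<open>Stated for every \<open>\<Delta>\<close>, because the right rule is met at
      renamed contexts from inside the derivation of \<open>A\<close>.\<close>
    have principal: "der (\<Omega>L @ \<Delta> @ \<Omega>R) C"
      if R: "right_premises \<Delta> A" and seq: "is_sequent (\<Omega>L @ \<Delta> @ \<Omega>R \<turnstile> C)" for \<Delta>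
    proof -
      have ord: "ordered_context (\<Omega>L @ \<Delta> @ \<Omega>R)"
        using seq by simp
      obtain y where y: "y \<notin> vars (\<Omega>L @ \<Delta> @ \<Omega>R)"
        using ex_fresh by blast
      obtain z where z: "z \<notin> vars ((y, A) # \<Omega>L @ \<Delta> @ \<Omega>R)"
        using ex_fresh by blast
      show ?thesis
      proof (cases A)
        case (LImp A1 A2)
        then obtain \<Omega> \<Omega>A where *: "\<Omega>L = \<Omega> @ \<Omega>A" "der \<Omega>A A1" "der (\<Omega> @ [(y, A2)] @ \<Omega>R) C"
          using prem y by auto
        \<comment> \<open>The argument context \<open>\<Omega>A\<close> is cut in for
          \<open>A1\<close> first; the resulting derivation of \<open>A2\<close> is then cut into
          the main premise.\<close>
        have "der ([] @ [(y, A1)] @ \<Delta>) A2"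
          using R y by (simp add: LImp image_Un)
        then have minor: "der ([] @ \<Omega>A @ \<Delta>) A2"
          by (rule cut[rotated 2, OF _ _ ord]) (use * y LImp in auto)
        have "der (\<Omega> @ (\<Omega>A @ \<Delta>) @ \<Omega>R) C"
          by (rule cut[OF _ _ *(3) _ ord]) (use minor * y LImp in auto)
        then show ?thesis
          by (simp add: *)
      next
        case (RImp A1 A2)
        then obtain \<Omega> \<Omega>A where *: "\<Omega>R = \<Omega>A @ \<Omega>" "der \<Omega>A A1" "der (\<Omega>L @ [(y, A2)] @ \<Omega>) C"
          using prem y by auto
        have "der (\<Delta> @ [(y, A1)] @ []) A2"
          using R y by (simp add: RImp image_Un)
        then have minor: "der (\<Delta> @ \<Omega>A @ []) A2"
          by (rule cut[rotated 2, OF _ _ ord]) (use * y RImp in auto)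
        have "der (\<Omega>L @ (\<Delta> @ \<Omega>A) @ \<Omega>) C"
          by (rule cut[OF _ _ *(3) _ ord]) (use minor * y RImp in auto)
        then show ?thesis
          by (simp add: *)
      next
        case (With A1 A2)
        then consider "der (\<Omega>L @ [(y, A1)] @ \<Omega>R) C" | "der (\<Omega>L @ [(y, A2)] @ \<Omega>R) C"
          using prem y by auto
        then show ?thesis
        proof cases
          case 1
          then show ?thesis
            by (rule cut[rotated 2, OF _ _ ord]) (use R y With in auto)
        next
          case 2
          then show ?thesis
            by (rule cut[rotated 2, OF _ _ ord]) (use R y With in auto)
        qed
      next
        case (Up m A1)
        then have "der (\<Omega>L @ [(y, A1)] @ \<Omega>R) C"
          using prem y by auto
        then show ?thesis
          by (rule cut[rotated 2, OF _ _ ord]) (use R y Up in auto)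
      next
        case (Fuse A1 A2)
        then obtain \<Delta>1 \<Delta>2 where *: "\<Delta> = \<Delta>1 @ \<Delta>2" "der \<Delta>1 A1" "der \<Delta>2 A2"
          using R by auto
        \<comment> \<open>Between the two cuts the context still contains \<open>z\<close> labeling
          \<open>A2\<close>, so the ambient context is enlarged by it.\<close>
        have ordz: "ordered_context ((z, A2) # \<Omega>L @ \<Delta> @ \<Omega>R)"
          using ord by (rule ordered_context_fresh[where y=z and B=A2])
            (use z derD(2)[OF *(3)] in auto)
        have "der (\<Omega>L @ [(y, A1)] @ ([(z, A2)] @ \<Omega>R)) C"
          using prem y z by (simp add: Fuse image_Un)
        then have "der (\<Omega>L @ \<Delta>1 @ ([(z, A2)] @ \<Omega>R)) C"
          by (rule cut[rotated 2, OF _ _ ordz]) (use * y z Fuse in auto)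
        then have "der ((\<Omega>L @ \<Delta>1) @ [(z, A2)] @ \<Omega>R) C"
          by simp
        then have "der ((\<Omega>L @ \<Delta>1) @ \<Delta>2 @ \<Omega>R) C"
          by (rule cut[rotated 2, OF _ _ ord]) (use * z Fuse in auto)
        then show ?thesis
          by (simp add: *)
      next
        case (One m)
        then show ?thesis
          using prem R by simp
      next
        case (Plus A1 A2)
        then have prems: "der (\<Omega>L @ [(y, A1)] @ \<Omega>R) C" "der (\<Omega>L @ [(y, A2)] @ \<Omega>R) C"
          using prem y by auto
        from Plus R consider "der \<Delta> A1" | "der \<Delta> A2"
          by auto
        then show ?thesis
        proof cases
          case 1
          then show ?thesis
            by (rule cut[OF _ _ prems(1) _ ord, rotated]) (use y Plus in auto)
        next
          case 2
          then show ?thesis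
            by (rule cut[OF _ _ prems(2) _ ord, rotated]) (use y Plus in auto)
        qed
      next
        case (Down m A1)
        then have "der (\<Omega>L @ [(y, A1)] @ \<Omega>R) C"
          using prem y by auto
        then show ?thesis
          by (rule cut[rotated 2, OF _ _ ord]) (use R y Down in auto)
      qed (use prem in simp)
    qed
    \<comment> \<open>With the identity renaming, \<open>der_left_commute\<close> speaks about
      \<open>\<Delta>\<close> itself; \<open>der_left_rule\<close> serves its identity leaves and
      \<open>principal\<close> its right rules.\<close>
    have id: "map (apfst (\<lambda>y. y)) \<Delta> = \<Delta>"
      by (simp add: apfst_def map_prod_def)
    show "der (\<Omega>L @ \<Delta> @ \<Omega>R) C"
      using der_left_commute[OF less.prems le der_left_rule[OF prem] principal, of "\<lambda>y. y"] seq
      unfolding id by blast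
  qed
qed

text \<open>One substitution sends every occurrence of \<open>(x, A)\<close> to
  \<open>\<Delta>\<close> and all other antecedents to themselves, in place of one cut per
  occurrence.\<close>

corollary der_multicut:
  assumes "der \<Delta> A" and "der \<Omega> C" and "ordered_context (replace_all (x, A) \<Delta> \<Omega>)"
  shows "der (replace_all (x, A) \<Delta> \<Omega>) C"
  unfolding replace_all_def
proof (rule der_subst[OF assms(2)])
  show "substitutable (\<lambda>b. if b = (x, A) then \<Delta> else [b]) \<Omega>"
    using assms(1) usable_if_der[OF assms(1)] substitutable_var[OF derD(1)[OF assms(2)]] by simp
qed (use assms(3) in \<open>simp add: replace_all_def\<close>)

end

theorem theorem1:
  fixes \<sigma> :: "'m::preorder \<Rightarrow> structural_property set"
    and \<Omega> \<Omega>A :: "('p, 'm) ctx"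
    and A C :: "('p, 'm) formula"
    and m r :: 'm
    and x :: var
    and n :: nat
  assumes "\<And>k l. k \<ge> l \<Longrightarrow> \<sigma> k \<supseteq> \<sigma> l"
    and "wf_prop A" and "mode A = m"
    and "wf_prop C" and "mode C = r"
    and "ctx_geq \<Omega>A m" and "m \<ge> r"
    and "compatible \<sigma> m n"
    and "count_list \<Omega> (x, A) = n"
    and "\<And>B. (x, B) \<in> set \<Omega> \<Longrightarrow> B = A"
    and "x \<notin> vars \<Omega>A"
    and "ordered_context (replace_all (x, A) \<Omega>A \<Omega>)"
    and "cut_free_provable \<sigma> (\<Omega>A \<turnstile> A)"
    and "cut_free_provable \<sigma> (\<Omega> \<turnstile> C)"
  shows "cut_free_provable \<sigma> (replace_all (x, A) \<Omega>A \<Omega> \<turnstile> C)"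
proof -
  interpret ordered_adjoint \<sigma>
    by standard (rule assms(1))
  show ?thesis
    using assms(13,14,12) by (rule der_multicut)
qed

end
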